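(* Let $k,\ell,r\in\mathbb{N}$ with $\ell\leq k$ and $k\geq2$. Then $S_r(k;\ell)$ exists if and only if $\ell\geq2$ or $r=1$.
   Context: $\mathbb{N}=\{1,2,\ldots\}$ is the set of positive integers. For $n,r\in\mathbb{N}$, an $r$-coloring of $\{1,\ldots,n\}$ is a function $\Delta:\{1,\ldots,n\}\to\{1,\ldots,r\}$. For $k\geq 2$ consider the equation \[ x_1+x_2+\cdots+x_k=x_{k+1}\qquad( * ) \] in which the variables are not required to be distinct. A solution $\mathcal{S}$ to $( * )$ in $\{1,\ldots,n\}$ (i.e. a tuple $(x_1,\ldots,x_{k+1})$ of elements of $\{1,\ldots,n\}$ satisfying $( * )$) is monochromatic under $\Delta$ if all integers occurring in it have the same color. For a solution $\mathcal{S}$, $c(\mathcal{S})$ denotes the number of distinct integers occurring among $x_1,\ldots,x_{k+1}$. For $r,k,\ell\in\mathbb{N}$ with $\ell\leq k$ and $k\geq2$, $S_r(k;\ell)$ denotes the smallest $n\in\mathbb{N}$, if it exists, such that every $r$-coloring of $\{1,2,\ldots,n\}$ has a monochromatic solution $\mathcal{S}$ to $( * )$ with $c(\mathcal{S})=\ell+1$; "$S_r(k;\ell)$ exists" means that at least one such $n$ exists. *)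

theory Defs
  imports Main "HOL-Library.FuncSet"
begin

text \<open>
  Tuples and colorings are total functions on \<open>nat\<close> of which only the values on the
  relevant index set (\<open>{1..k+1}\<close>, resp. \<open>{1..n}\<close>) matter.
\<close>

definition coloring :: "nat \<Rightarrow> nat \<Rightarrow> (nat \<Rightarrow> nat) \<Rightarrow> bool" where
  "coloring r n \<Delta> \<longleftrightarrow> \<Delta> \<in> {1..n} \<rightarrow> {1..r}"

definition solution :: "nat \<Rightarrow> nat \<Rightarrow> (nat \<Rightarrow> nat) \<Rightarrow> bool" where
  "solution k n x \<longleftrightarrow> x \<in> {1..k+1} \<rightarrow> {1..n} \<and> (\<Sum>i=1..k. x i) = x (k+1)"

definition monochromatic :: "nat \<Rightarrow> (nat \<Rightarrow> nat) \<Rightarrow> (nat \<Rightarrow> nat) \<Rightarrow> bool" where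
  "monochromatic k \<Delta> x \<longleftrightarrow> (\<forall>i\<in>{1..k+1}. \<forall>j\<in>{1..k+1}. \<Delta> (x i) = \<Delta> (x j))"

definition num_distinct :: "nat \<Rightarrow> (nat \<Rightarrow> nat) \<Rightarrow> nat" where
  "num_distinct k x = card (x ` {1..k+1})"

definition forces :: "nat \<Rightarrow> nat \<Rightarrow> nat \<Rightarrow> nat \<Rightarrow> bool" where
  "forces r k l n \<longleftrightarrow>
     (\<forall>\<Delta>. coloring r n \<Delta> \<longrightarrow>
        (\<exists>x. solution k n x \<and> monochromatic k \<Delta> x \<and> num_distinct k x = l + 1))"

text \<open>\<open>S r k l\<close> is the number \<open>S\<^sub>r(k;l)\<close>, with \<open>None\<close> meaning that it does not exist.\<close>

definition S :: "nat \<Rightarrow> nat \<Rightarrow> nat \<Rightarrow> nat option" where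
  "S r k l =
     (if \<exists>n\<ge>1. forces r k l n then Some (LEAST n. 1 \<le> n \<and> forces r k l n) else None)"

end

(* For l >= 2 put m = k - l and look for monochromatic y, e, D with e in D, |D| = l - 1, y not in D
   and y + m e + sum D of the same color. Induct on the number of colors. Van der Waerden's theorem
   (proved by color focusing) gives a long monochromatic progression with difference d. If l - 1
   small multiples of d have its color, they form D, and y and y + m e + sum D both lie on the
   progression. Otherwise that color is so rare among the multiples of d that some dilate
   {u, 2u, ..., N u} avoids it, and one color has been removed.
   For l = 1 a solution is (a, ..., a, k a), and the parity of the exponent of k separates a from
   k a. *)
theory Submission
  imports Defs "HOL-Computational_Algebra.Primes"
begin

section \<open>Van der Waerden's theorem by color focusing\<close>

text \<open>Encodes the color pattern of a window of \<open>n\<close> consecutive integers as a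
  single color below \<open>R\<close>, so that van der Waerden's theorem for shorter progressions
  applies to whole windows.\<close>

lemma ex_inj_window:
  "\<exists>R. \<exists>h :: nat list \<Rightarrow> nat. inj_on h {xs. set xs \<subseteq> {..<r} \<and> length xs = n}
     \<and> h ` {xs. set xs \<subseteq> {..<r} \<and> length xs = n} \<subseteq> {..<R}"
proof -
  let ?L = "{xs. set xs \<subseteq> {..<r::nat} \<and> length xs = n}"
  have "finite ?L" by (rule finite_lists_length_eq) simp
  then obtain h where "bij_betw h ?L {0..<card ?L}"
    using ex_bij_betw_finite_nat by blast
  then have "inj_on h ?L" "h ` ?L \<subseteq> {..<card ?L}"
    by (auto simp: bij_betw_def)
  then show ?thesis by blast
qed

text \<open>The bound also covers \<open>a + k * d\<close>, the term after the \<open>k\<close>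
  equally colored ones, so that a focus stays in range.\<close>

definition mono_ap :: "nat \<Rightarrow> nat \<Rightarrow> (nat \<Rightarrow> 'c) \<Rightarrow> bool" where
  "mono_ap k N \<chi> \<longleftrightarrow> (\<exists>a d. 0 < d \<and> a + k * d \<le> N \<and> (\<forall>i<k. \<chi> (a + i * d) = \<chi> a))"

lemma mono_ap_shift:
  assumes "mono_ap k N (\<lambda>x. \<chi> (x + t))" "N + t \<le> N'"
  shows "mono_ap k N' \<chi>"
proof -
  obtain a d where "0 < d" "a + k * d \<le> N" "\<forall>i<k. \<chi> (a + i * d + t) = \<chi> (a + t)"
    using assms(1) unfolding mono_ap_def by blast
  then show ?thesis unfolding mono_ap_def using assms(2)
    by (intro exI[of _ "a + t"] exI[of _ d]) (auto simp: algebra_simps)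
qed

text \<open>Monochromatic progressions of length \<open>k\<close> in \<open>s\<close> different colors that all have the same
  next term \<open>f\<close>.\<close>

definition focused :: "nat \<Rightarrow> nat \<Rightarrow> nat \<Rightarrow> (nat \<Rightarrow> 'c) \<Rightarrow> bool" where
  "focused k s N \<chi> \<longleftrightarrow> (\<exists>f p d. f \<le> N \<and> inj_on (\<lambda>j. \<chi> (p j)) {..<s} \<and>
     (\<forall>j<s. 0 < d j \<and> p j + k * d j = f \<and> (\<forall>i<k. \<chi> (p j + i * d j) = \<chi> (p j))))"

text \<open>Color focusing. Among windows of length \<open>N + 1\<close>, take \<open>k\<close>
  identically colored ones in progression with difference \<open>D\<close>. Either the first
  contains a longer monochromatic progression, or it contains \<open>s\<close> focused ones.
  Stepping from window to window while moving along each of these keeps their colors, and the copies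
  of the focus form one more progression.\<close>

lemma ex_focused:
  fixes k r s :: nat
  assumes k: "1 \<le> k"
    and W: "\<And>r. \<exists>N. \<forall>\<chi> :: nat \<Rightarrow> nat. (\<forall>x. \<chi> x < r) \<longrightarrow> mono_ap k N \<chi>"
  shows "\<exists>N. \<forall>\<chi> :: nat \<Rightarrow> nat. (\<forall>x. \<chi> x < r) \<longrightarrow> mono_ap (Suc k) N \<chi> \<or> focused k s N \<chi>"
proof (induction s)
  case 0
  show ?case by (auto simp: focused_def)
next
  case (Suc s)
  then obtain N where N: "\<And>\<chi> :: nat \<Rightarrow> nat. \<forall>x. \<chi> x < r \<Longrightarrow> mono_ap (Suc k) N \<chi> \<or> focused k s N \<chi>"
    by blast
  let ?L = "{xs. set xs \<subseteq> {..<r} \<and> length xs = N + 1}"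
  obtain R h where h: "inj_on h ?L" "h ` ?L \<subseteq> {..<R::nat}"
    using ex_inj_window by blast
  obtain M where M: "\<And>\<chi> :: nat \<Rightarrow> nat. \<forall>x. \<chi> x < R \<Longrightarrow> mono_ap k M \<chi>"
    using W by blast
  show ?case
  proof (intro exI[of _ "M + 2 * N"] allI impI)
    fix \<chi> :: "nat \<Rightarrow> nat" assume \<chi>: "\<forall>x. \<chi> x < r"
    define w where "w x = map (\<lambda>i. \<chi> (x + i)) [0..<N + 1]" for x
    have wL: "w x \<in> ?L" for x using \<chi> by (auto simp: w_def)
    then have "\<forall>x. h (w x) < R" using h(2) by blast
    from M[OF this] obtain x D where D: "0 < D" "x + k * D \<le> M"
      and eq: "\<And>i. i < k \<Longrightarrow> h (w (x + i * D)) = h (w x)"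
      unfolding mono_ap_def by blast
    have weq: "\<chi> (x + i * D + t) = \<chi> (x + t)" if "i < k" "t \<le> N" for i t
    proof -
      have "w (x + i * D) = w x" using eq[OF that(1)] h(1) wL by (auto dest: inj_onD)
      then have "w (x + i * D) ! t = w x ! t" by simp
      then show ?thesis using that(2) by (simp add: w_def del: upt_Suc)
    qed
    have xM: "x \<le> M" using D by simp
    \<comment> \<open>The induction hypothesis is applied to the first window, which starts at
      \<open>x\<close>.\<close>
    from N[of "\<lambda>t. \<chi> (t + x)"] \<chi>
    consider "mono_ap (Suc k) N (\<lambda>t. \<chi> (t + x))" | "focused k s N (\<lambda>t. \<chi> (t + x))" by blast
    then show "mono_ap (Suc k) (M + 2 * N) \<chi> \<or> focused k (Suc s) (M + 2 * N) \<chi>"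
    proof cases
      case 1
      then show ?thesis using mono_ap_shift[of "Suc k" N \<chi> x] xM by simp
    next
      case 2
      then obtain f p d where f: "f \<le> N" and inj: "inj_on (\<lambda>j. \<chi> (p j + x)) {..<s}"
        and d: "\<And>j. j < s \<Longrightarrow> 0 < d j" and pf: "\<And>j. j < s \<Longrightarrow> p j + k * d j = f"
        and mono: "\<And>j i. j < s \<Longrightarrow> i < k \<Longrightarrow> \<chi> (p j + i * d j + x) = \<chi> (p j + x)"
        unfolding focused_def by blast
      show ?thesis
      \<comment> \<open>If the focus has the color of one of its progressions, it extends that
        progression to length \<open>k + 1\<close>. Otherwise its color is new.\<close>
      proof (cases "\<exists>j<s. \<chi> (f + x) = \<chi> (p j + x)")
        case True
        then obtain j where j: "j < s" "\<chi> (f + x) = \<chi> (p j + x)" by blast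
        have "\<chi> (p j + x + i * d j) = \<chi> (p j + x)" if "i < Suc k" for i
        proof (cases "i = k")
          case True
          then show ?thesis using pf[OF j(1)] j(2) by (simp add: algebra_simps)
        next
          case False
          then have "i < k" using that by simp
          from mono[OF j(1) this] show ?thesis by (simp add: algebra_simps)
        qed
        \<comment> \<open>The longer progression must leave room for the term after the focus,
          \<open>f + x + d j\<close>. Since \<open>d j \<le> f \<le> N\<close>, this explains the
          bound \<open>M + 2 * N\<close>.\<close>
        moreover have "d j \<le> f" using pf[OF j(1)] k mult_le_mono1[OF k, of "d j"] by linarith
        then have "p j + x + Suc k * d j \<le> M + 2 * N" using pf[OF j(1)] f xM by simp
        ultimately show ?thesis using d[OF j(1)] unfolding mono_ap_def by blast
      next
        case False
        \<comment> \<open>Old differences grow by \<open>D\<close>. The new progression runs through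
          the copies of \<open>f\<close> in the \<open>k\<close> windows. All of them meet at
          \<open>f + x + k * D\<close>.\<close>
        let ?p = "\<lambda>j. if j < s then p j + x else f + x"
        let ?d = "\<lambda>j. if j < s then d j + D else D"
        have "focused k (Suc s) (M + 2 * N) \<chi>" unfolding focused_def
        proof (rule exI[of _ "f + x + k * D"], rule exI[of _ ?p], rule exI[of _ ?d],
            intro conjI allI impI)
          show "f + x + k * D \<le> M + 2 * N" using f D(2) by simp
          show "inj_on (\<lambda>j. \<chi> (?p j)) {..<Suc s}"
            using inj False unfolding inj_on_def by (auto simp: less_Suc_eq)
          fix j assume "j < Suc s"
          show "0 < ?d j" using D by simp
          show "?p j + k * ?d j = f + x + k * D"
            using pf by (auto simp: algebra_simps)
          fix i assume i: "i < k"
          show "\<chi> (?p j + i * ?d j) = \<chi> (?p j)"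
          proof (cases "j < s")
            case True
            have "i * d j \<le> k * d j" using i by simp
            then have "p j + i * d j \<le> N" using pf[OF True] f by linarith
            from weq[OF i this] mono[OF True i] show ?thesis
              using True by (simp add: algebra_simps)
          next
            case False
            then show ?thesis using weq[OF i f] by (simp add: algebra_simps)
          qed
        qed
        then show ?thesis ..
      qed
    qed
  qed
qed

text \<open>With \<open>s = Suc r\<close> the focused alternative would need more than
  \<open>r\<close> colors, so only the progression remains.\<close>

lemma van_der_Waerden_aux:
  "\<exists>N. \<forall>\<chi> :: nat \<Rightarrow> nat. (\<forall>x. \<chi> x < r) \<longrightarrow> mono_ap (Suc k) N \<chi>"
proof (induction k arbitrary: r)
  case 0
  show ?case unfolding mono_ap_def
    by (rule exI[of _ 1], intro allI impI exI[of _ 0] exI[of _ 1]) simp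
next
  case (Suc k)
  obtain N where N: "\<And>\<chi> :: nat \<Rightarrow> nat. \<forall>x. \<chi> x < r \<Longrightarrow>
      mono_ap (Suc (Suc k)) N \<chi> \<or> focused (Suc k) (Suc r) N \<chi>"
    using ex_focused[of "Suc k" r "Suc r"] Suc.IH by auto
  have "\<not> focused (Suc k) (Suc r) N \<chi>" if "\<forall>x. \<chi> x < r" for \<chi> :: "nat \<Rightarrow> nat"
  proof
    assume "focused (Suc k) (Suc r) N \<chi>"
    then obtain p where "inj_on (\<lambda>j. \<chi> (p j)) {..<Suc r}" unfolding focused_def by blast
    moreover have "(\<lambda>j. \<chi> (p j)) ` {..<Suc r} \<subseteq> {..<r}" using that by auto
    ultimately have "card {..<Suc r} \<le> card {..<r}" by (intro card_inj_on_le) auto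
    then show False by simp
  qed
  with N show ?case by blast
qed

theorem van_der_Waerden:
  obtains N where "\<And>(\<chi> :: nat \<Rightarrow> 'c) C. \<lbrakk>finite C; card C = r; \<chi> ` {1..N} \<subseteq> C\<rbrakk> \<Longrightarrow>
    \<exists>a d. 0 < a \<and> 0 < d \<and> a + k * d \<le> N \<and> (\<forall>i\<le>k. \<chi> (a + i * d) = \<chi> a)"
proof -
  obtain N where N: "\<And>\<chi> :: nat \<Rightarrow> nat. \<forall>x. \<chi> x < r \<Longrightarrow> mono_ap (Suc k) N \<chi>"
    using van_der_Waerden_aux by blast
  have "\<exists>a d. 0 < a \<and> 0 < d \<and> a + k * d \<le> Suc N \<and> (\<forall>i\<le>k. \<chi> (a + i * d) = \<chi> a)"
    if C: "finite C" "card C = r" "\<chi> ` {1..Suc N} \<subseteq> C" for \<chi> :: "nat \<Rightarrow> 'c" and C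
  proof -
    obtain h where h: "bij_betw h C {0..<r}"
      using ex_bij_betw_finite_nat C(1,2) by blast
    \<comment> \<open>Capping at \<open>N\<close> makes the coloring total without changing it on
      \<open>{0..N}\<close>; the shift by \<open>Suc\<close> makes the first term positive.\<close>
    let ?\<chi> = "\<lambda>x. h (\<chi> (Suc (min x N)))"
    have inC: "\<chi> (Suc (min x N)) \<in> C" for x using C(3) by auto
    then have "?\<chi> x < r" for x using bij_betwE[OF h] by auto
    then obtain a d where ad: "0 < d" "a + Suc k * d \<le> N"
      and m: "\<And>i. i < Suc k \<Longrightarrow> ?\<chi> (a + i * d) = ?\<chi> a"
      using N[of ?\<chi>] unfolding mono_ap_def by blast
    have "\<chi> (Suc a + i * d) = \<chi> (Suc a)" if "i \<le> k" for i
    proof -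
      have "i * d \<le> k * d" using that by (rule mult_le_mono1)
      then have "a + i * d \<le> N" "a \<le> N" using ad(2) unfolding mult_Suc by linarith+
      then show ?thesis
        using m[of i] that inC[of "a + i * d"] inC[of a] h
        by (auto simp: bij_betw_def min_absorb1 dest: inj_onD)
    qed
    then show ?thesis using ad by (intro exI[of _ "Suc a"] exI[of _ d]) auto
  qed
  then show ?thesis using that by blast
qed

section \<open>Monochromatic sums with a repeated summand\<close>

text \<open>The solutions of the equation in which \<open>e\<close> occurs \<open>m + 1\<close> times on the left-hand side, and
  \<open>y\<close> and the other elements of \<open>D\<close> once each.\<close>

definition mono_sum :: "nat \<Rightarrow> nat \<Rightarrow> nat \<Rightarrow> (nat \<Rightarrow> 'c) \<Rightarrow> bool" where
  "mono_sum m q N \<chi> \<longleftrightarrow> (\<exists>D e y. finite D \<and> card D = q \<and> e \<in> D \<and> y \<notin> D \<and> 0 \<notin> D \<and> 0 < y \<and>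
     y + m * e + \<Sum>D \<le> N \<and> (\<forall>x\<in>D. \<chi> x = \<chi> y) \<and> \<chi> (y + m * e + \<Sum>D) = \<chi> y)"

text \<open>The equation is homogeneous, so a configuration found in the dilate by \<open>u\<close>
  can be multiplied by \<open>u\<close>.\<close>

lemma mono_sum_scale:
  assumes "mono_sum m q N (\<lambda>s. \<chi> (u * s))" "0 < u" "u * N \<le> N'"
  shows "mono_sum m q N' \<chi>"
proof -
  obtain D e y where D: "finite D" "card D = q" "e \<in> D" "y \<notin> D" "0 \<notin> D" "0 < y"
     "y + m * e + \<Sum>D \<le> N" "\<forall>x\<in>D. \<chi> (u * x) = \<chi> (u * y)"
     "\<chi> (u * (y + m * e + \<Sum>D)) = \<chi> (u * y)"
    using assms(1) unfolding mono_sum_def by blast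
  have inj: "inj_on ((*) u) D" using assms(2) by (auto simp: inj_on_def)
  have sum: "\<Sum>((*) u ` D) = u * \<Sum>D"
    using inj by (simp add: sum.reindex sum_distrib_left)
  have eq: "u * y + m * (u * e) + \<Sum>((*) u ` D) = u * (y + m * e + \<Sum>D)"
    unfolding sum by (simp add: algebra_simps)
  have le: "u * (y + m * e + \<Sum>D) \<le> N'"
    using mult_le_mono2[OF D(7), of u] assms(3) by (rule order_trans)
  show ?thesis unfolding mono_sum_def
    by (rule exI[of _ "(*) u ` D"], rule exI[of _ "u * e"], rule exI[of _ "u * y"])
      (use D eq inj assms(2) le in \<open>simp add: card_image image_iff\<close>)
qed

text \<open>Colors come from an arbitrary finite set \<open>C\<close>, so that deleting one color
  leaves an instance of the induction hypothesis.\<close>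

lemma ex_mono_sum:
  fixes m q r :: nat
  assumes q: "1 \<le> q"
  shows "\<exists>N\<ge>1. \<forall>(\<chi> :: nat \<Rightarrow> 'c) C. finite C \<longrightarrow> card C = r \<longrightarrow> \<chi> ` {1..N} \<subseteq> C \<longrightarrow> mono_sum m q N \<chi>"
proof (induction r)
  case 0
  show ?case by (intro exI[of _ 1]) auto
next
  case (Suc r)
  then obtain N0 where N0: "N0 \<ge> 1"
    and IH: "\<And>(\<chi> :: nat \<Rightarrow> 'c) C. \<lbrakk>finite C; card C = r; \<chi> ` {1..N0} \<subseteq> C\<rbrakk> \<Longrightarrow> mono_sum m q N0 \<chi>"
    by blast
  \<comment> \<open>\<open>B\<close> exceeds every \<open>s \<le> N0\<close>, which separates the
    dilates of \<open>{1..N0}\<close> by \<open>B ^ i\<close>, \<open>i < q\<close>; all of them lie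
    below \<open>M\<close>. \<open>K\<close> bounds \<open>i + m * j + \<Sum>J'\<close> for
    \<open>i \<le> q\<close> and \<open>q\<close> indices of size at most \<open>M\<close>.\<close>
  define B where "B = N0 + 1"
  define M where "M = B ^ q"
  define K where "K = q + (m + q) * M"
  obtain N where N: "\<And>(\<chi> :: nat \<Rightarrow> 'c) C. \<lbrakk>finite C; card C = Suc r; \<chi> ` {1..N} \<subseteq> C\<rbrakk> \<Longrightarrow>
    \<exists>a d. 0 < a \<and> 0 < d \<and> a + K * d \<le> N \<and> (\<forall>i\<le>K. \<chi> (a + i * d) = \<chi> a)"
    using van_der_Waerden[of "Suc r" K] by blast
  have "mono_sum m q (max 1 N) \<chi>" if C: "finite C" "card C = Suc r" "\<chi> ` {1..max 1 N} \<subseteq> C"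
    for \<chi> :: "nat \<Rightarrow> 'c" and C
  proof -
    have "\<chi> ` {1..N} \<subseteq> C" using C(3) by auto
    from N[OF C(1,2) this] obtain a d where ad: "0 < a" "0 < d" "a + K * d \<le> N"
      and mono: "\<And>i. i \<le> K \<Longrightarrow> \<chi> (a + i * d) = \<chi> a"
      by blast
    have "1 * M \<le> (m + q) * M" using q by (intro mult_le_mono1) simp
    then have MK: "M \<le> K" unfolding K_def by linarith
    have MN: "M * d \<le> N" using mult_le_mono1[OF MK, of d] ad(3) by linarith
    \<comment> \<open>The small multiples of \<open>d\<close> that have the color of the
      progression.\<close>
    define J where "J = {j\<in>{1..M}. \<chi> (j * d) = \<chi> a}"
    have finJ: "finite J" by (simp add: J_def)
    show ?thesis
    proof (cases "q \<le> card J")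
      case True
      then obtain J' where J': "J' \<subseteq> J" "card J' = q" "finite J'"
        using obtain_subset_with_card_n by blast
      define D where "D = (\<lambda>j. j * d) ` J'"
      have inj: "inj_on (\<lambda>j. j * d) J'" using ad(2) by (auto simp: inj_on_def)
      have D: "finite D" "card D = q" using J' inj by (auto simp: D_def card_image)
      have sumD: "\<Sum>D = \<Sum>J' * d" unfolding D_def using inj
        by (simp add: sum.reindex sum_distrib_right)
      obtain j where j: "j \<in> J'" using J'(2) q by fastforce
      \<comment> \<open>By pigeonhole one of the \<open>q + 1\<close> terms
        \<open>a + i * d\<close>, \<open>i \<le> q\<close>, is outside \<open>D\<close>; it serves
        as \<open>y\<close>.\<close>
      have "\<not> (\<lambda>i. a + i * d) ` {..q} \<subseteq> D"
      proof
        assume "(\<lambda>i. a + i * d) ` {..q} \<subseteq> D"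
        moreover have "inj_on (\<lambda>i. a + i * d) {..q}" using ad(2) by (auto simp: inj_on_def)
        ultimately have "card {..q} \<le> card D" using D(1) by (intro card_inj_on_le)
        then show False using D(2) by simp
      qed
      then obtain i where i: "i \<le> q" "a + i * d \<notin> D" by auto
      \<comment> \<open>As \<open>D\<close> consists of multiples of \<open>d\<close>, the total is
        the term of index \<open>t\<close> of the progression.\<close>
      define t where "t = i + m * j + \<Sum>J'"
      have J'M: "j' \<le> M" if "j' \<in> J'" for j' using that J'(1) by (auto simp: J_def)
      have "\<Sum>J' \<le> q * M" using sum_bounded_above[of J' "\<lambda>x. x" M] J'M J'(2) by simp
      moreover have "m * j \<le> m * M" using J'M[OF j] by (rule mult_le_mono2)
      ultimately have tK: "t \<le> K" using i(1) unfolding t_def K_def add_mult_distrib by linarith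
      have eq: "a + i * d + m * (j * d) + \<Sum>D = a + t * d"
        by (simp add: sumD t_def algebra_simps)
      have "t * d \<le> K * d" using tK by (rule mult_le_mono1)
      then have le: "a + t * d \<le> max 1 N" using ad(3) by linarith
      have iK: "i \<le> K" using i(1) by (simp add: K_def)
      have colD: "\<forall>x\<in>D. \<chi> x = \<chi> a" using J'(1) by (auto simp: D_def J_def)
      have D0: "0 \<notin> D" using J'(1) ad(2) by (auto simp: D_def J_def)
      show ?thesis unfolding mono_sum_def
      proof (rule exI[of _ D], rule exI[of _ "j * d"], rule exI[of _ "a + i * d"], unfold eq,
          intro conjI)
        show "j * d \<in> D" using j unfolding D_def by (rule imageI)
      qed (use D i(2) ad(1) le colD D0 mono[OF iK] mono[OF tK] in auto)
    next
      case False
      \<comment> \<open>The \<open>q\<close> sets \<open>{B ^ i * s | s. 1 \<le> s \<le> N0}\<close> are disjoint.\<close>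
      have "\<exists>i<q. \<forall>s\<in>{1..N0}. B ^ i * s \<notin> J"
      proof (rule ccontr)
        assume "\<not> ?thesis"
        then have "\<forall>i\<in>{..<q}. \<exists>s. s \<in> {1..N0} \<and> B ^ i * s \<in> J" by blast
        then obtain g where g: "\<And>i. i < q \<Longrightarrow> g i \<in> {1..N0} \<and> B ^ i * g i \<in> J"
          by (metis lessThan_iff)
        have neq: "B ^ i * g i < B ^ j * g j" if "i < j" "j < q" for i j
        proof -
          have "g i < B" using g[of i] that by (simp add: B_def)
          then have "B ^ i * g i < B ^ i * B" by (rule mult_less_mono2) (simp add: B_def)
          also have "\<dots> = B ^ Suc i" by simp
          also have "\<dots> \<le> B ^ j" using that by (intro power_increasing) (auto simp: B_def)
          also have "\<dots> \<le> B ^ j * g j" using g[of j] that by simp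
          finally show ?thesis .
        qed
        have "inj_on (\<lambda>i. B ^ i * g i) {..<q}"
          by (intro linorder_inj_onI) (use neq in \<open>auto dest: less_imp_neq\<close>)
        then have "card {..<q} \<le> card J" using g finJ by (intro card_inj_on_le) auto
        then show False using False by simp
      qed
      then obtain i where i: "i < q" and nJ: "\<And>s. s \<in> {1..N0} \<Longrightarrow> B ^ i * s \<notin> J" by blast
      \<comment> \<open>The numbers \<open>u * s\<close> with \<open>1 \<le> s \<le> N0\<close> all
        avoid the color \<open>\<chi> a\<close>, so the dilate by \<open>u\<close> uses at most
        \<open>r\<close> colors.\<close>
      define u where "u = d * B ^ i"
      have B0: "0 < B" by (simp add: B_def)
      have le: "B ^ i * s \<le> M" if "s \<le> N0" for s
      proof -
        have "s \<le> B" using that by (simp add: B_def)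
        then have "B ^ i * s \<le> B ^ i * B" by (rule mult_le_mono2)
        also have "\<dots> = B ^ Suc i" by simp
        also have "\<dots> \<le> M" unfolding M_def using i B0 by (intro power_increasing) auto
        finally show ?thesis .
      qed
      have uN: "u * s \<le> N" if "s \<le> N0" for s
      proof -
        have "B ^ i * s * d \<le> M * d" using le[OF that] by (rule mult_le_mono1)
        also note MN
        finally show ?thesis by (simp add: u_def mult_ac)
      qed
      have "0 < u" using ad(2) B0 by (simp add: u_def)
      have "(\<lambda>s. \<chi> (u * s)) ` {1..N0} \<subseteq> C - {\<chi> a}"
      proof clarify
        fix s assume s: "s \<in> {1..N0}"
        have "u * s \<in> {1..max 1 N}" using uN[of s] s \<open>0 < u\<close> by auto
        then have "\<chi> (u * s) \<in> C" using C(3) by blast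
        moreover have "\<chi> (B ^ i * s * d) \<noteq> \<chi> a" using nJ[OF s] le[of s] s B0 by (auto simp: J_def Suc_le_eq)
        then have "\<chi> (u * s) \<noteq> \<chi> a" by (simp add: u_def algebra_simps)
        ultimately show "\<chi> (u * s) \<in> C - {\<chi> a}" by simp
      qed
      moreover have "a \<in> {1..max 1 N}" using ad by auto
      then have "\<chi> a \<in> C" using C(3) by blast
      then have "card (C - {\<chi> a}) = r" using C(2) by simp
      ultimately have "mono_sum m q N0 (\<lambda>s. \<chi> (u * s))" using C(1)
        by (intro IH[of "C - {\<chi> a}"]) simp_all
      then show ?thesis by (rule mono_sum_scale) (use \<open>0 < u\<close> uN[of N0] in auto)
    qed
  qed
  then show ?case by (intro exI[of _ "max 1 N"]) auto
qed

section \<open>From lists of summands to solutions\<close>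

lemma solution_of_list:
  assumes "length xs = k" "set xs \<subseteq> {1..n}" "sum_list xs \<le> n" "1 \<le> k"
    and mono: "\<And>x. x \<in> set xs \<Longrightarrow> \<Delta> x = \<Delta> (sum_list xs)"
    and new: "sum_list xs \<notin> set xs"
  shows "\<exists>x. solution k n x \<and> monochromatic k \<Delta> x \<and> num_distinct k x = card (set xs) + 1"
proof -
  let ?ys = "xs @ [sum_list xs]"
  \<comment> \<open>Tuples are indexed from 1, lists from 0.\<close>
  define x where "x i = ?ys ! (i - 1)" for i
  have im: "x ` {1..k+1} = insert (sum_list xs) (set xs)"
  proof -
    have "{1..k+1} = Suc ` {..<k+1}" by (auto simp: image_iff Suc_le_eq gr0_conv_Suc)
    then have "x ` {1..k+1} = (!) ?ys ` {..<length ?ys}"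
      using assms(1) by (simp add: x_def image_image del: nth_append_length)
    also have "\<dots> = set ?ys" by (auto simp: set_conv_nth simp del: length_append)
    finally show ?thesis by simp
  qed
  have "(\<Sum>i=1..k. x i) = (\<Sum>i<k. x (Suc i))"
    by (simp add: sum.atLeast1_atMost_eq)
  also have "\<dots> = (\<Sum>i<k. xs ! i)" using assms(1) by (intro sum.cong) (auto simp: x_def nth_append)
  also have "\<dots> = x (k + 1)" using assms(1) sum_list_sum_nth[of xs]
    by (simp add: x_def nth_append atLeast0LessThan)
  finally have sum: "(\<Sum>i=1..k. x i) = x (k + 1)" .
  obtain z where "z \<in> set xs" using assms(1,4) by (cases xs) auto
  then have "1 \<le> sum_list xs" using assms(2) member_le_sum_list[of z xs] by force
  then have "x ` {1..k+1} \<subseteq> {1..n}" using im assms(2,3) by auto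
  then have "solution k n x" using sum unfolding solution_def by blast
  moreover have "\<Delta> (x i) = \<Delta> (sum_list xs)" if "i \<in> {1..k+1}" for i
  proof -
    have "x i \<in> insert (sum_list xs) (set xs)" using that im by blast
    then show ?thesis using mono by auto
  qed
  then have "monochromatic k \<Delta> x" by (simp add: monochromatic_def)
  moreover have "num_distinct k x = card (set xs) + 1" using im new by (simp add: num_distinct_def)
  ultimately show ?thesis by blast
qed

text \<open>The summands are \<open>y\<close>, the elements of \<open>D\<close> and \<open>m\<close>
  further copies of \<open>e\<close>. Both \<open>y\<close> and \<open>e\<close> are positive, so
  the sum exceeds each summand and adds one value to the \<open>q + 1\<close> values on the
  left.\<close>

lemma mono_sum_imp_solution:
  assumes "mono_sum m q n \<Delta>"
  shows "\<exists>x. solution (m + q + 1) n x \<and> monochromatic (m + q + 1) \<Delta> x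
    \<and> num_distinct (m + q + 1) x = q + 2"
proof -
  obtain D e y where D: "finite D" "card D = q" "e \<in> D" "y \<notin> D" "0 \<notin> D" "0 < y"
    and n: "y + m * e + \<Sum>D \<le> n" and col: "\<forall>x\<in>D. \<Delta> x = \<Delta> y" "\<Delta> (y + m * e + \<Sum>D) = \<Delta> y"
    using assms unfolding mono_sum_def by blast
  define xs where "xs = y # replicate m e @ sorted_list_of_set D"
  have set: "set xs = insert y D" using D by (auto simp: xs_def)
  have "sum_list (sorted_list_of_set D) = \<Sum>D"
    using D(1) sum_list_distinct_conv_sum_set[of "sorted_list_of_set D" "\<lambda>x. x"] by simp
  then have sum: "sum_list xs = y + m * e + \<Sum>D" by (simp add: xs_def sum_list_replicate)
  have lt: "x < sum_list xs" if "x \<in> set xs" for x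
  proof (cases "x = y")
    case True
    have "e \<le> \<Sum>D" using D(1,3) by (intro member_le_sum) auto
    moreover have "0 < e" using D(3,5) by (cases e) auto
    ultimately show ?thesis using True sum by simp
  next
    case False
    then have "x \<le> \<Sum>D" using D(1) that set by (intro member_le_sum) auto
    then show ?thesis using sum D(6) by simp
  qed
  have "set xs \<subseteq> {1..n}"
  proof
    fix x assume x: "x \<in> set xs"
    then have "0 < x" using set D(5,6) by (cases x) auto
    then show "x \<in> {1..n}" using lt[OF x] sum n by simp
  qed
  moreover have "length xs = m + q + 1" using D(1,2) by (simp add: xs_def)
  moreover have "card (set xs) = q + 1" using set D by simp
  ultimately show ?thesis
    using solution_of_list[of xs "m + q + 1" n \<Delta>] sum n col set lt by fastforce
qed

section \<open>Solutions with two values and the parity coloring\<close>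

text \<open>As \<open>k \<ge> 2\<close>, every summand is smaller than the sum. The sum thus uses up
  one of the two values, and the summands share the other.\<close>

lemma two_distinct_solution:
  assumes "solution k n x" "num_distinct k x = 2" "2 \<le> k"
  shows "0 < x 1" "x (k + 1) = k * x 1"
proof -
  have pos: "0 < x i" if "i \<in> {1..k+1}" for i
  proof -
    have "x i \<in> {1..n}" using assms(1) that unfolding solution_def by blast
    then show ?thesis by simp
  qed
  then show "0 < x 1" by simp
  have sum: "(\<Sum>i=1..k. x i) = x (k + 1)" using assms(1) by (simp add: solution_def)
  have lt: "x i < x (k + 1)" if "i \<in> {1..k}" for i
  proof -
    define j where "j = (if i = 1 then 2 else 1 :: nat)"
    have j: "j \<in> {1..k}" "j \<noteq> i" using assms(3) by (simp_all add: j_def)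
    have "x i + x j = (\<Sum>i\<in>{i,j}. x i)" using j by simp
    also have "\<dots> \<le> (\<Sum>i=1..k. x i)" using that j by (intro sum_mono2) auto
    finally show ?thesis using sum pos[of j] j by simp
  qed
  have const: "x i = x 1" if "i \<in> {1..k}" for i
  proof (rule ccontr)
    assume "x i \<noteq> x 1"
    then have "card {x 1, x i, x (k + 1)} = 3" using lt[of i] lt[of 1] that assms(3) by simp
    moreover have "{x 1, x i, x (k + 1)} \<subseteq> x ` {1..k+1}" using that by auto
    then have "card {x 1, x i, x (k + 1)} \<le> num_distinct k x"
      unfolding num_distinct_def by (intro card_mono) auto
    ultimately show False using assms(2) by simp
  qed
  have "(\<Sum>i=1..k. x i) = (\<Sum>i=1..k. x 1)" by (intro sum.cong[OF refl] const)
  then show "x (k + 1) = k * x 1" using sum by simp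
qed

text \<open>Multiplying a positive number by \<open>k\<close> raises the exponent of
  \<open>k\<close> by exactly one, also for composite \<open>k\<close>. Its parity therefore differs
  between the summand and the sum.\<close>

lemma not_forces_one:
  assumes "2 \<le> k" "2 \<le> r"
  shows "\<not> forces r k 1 n"
proof
  assume F: "forces r k 1 n"
  define \<Delta> where "\<Delta> x = 1 + multiplicity k x mod 2" for x :: nat
  have "\<Delta> x \<in> {1..r}" for x
    using assms(2) mod_less_divisor[of 2 "multiplicity k x"] by (auto simp: \<Delta>_def)
  then have "coloring r n \<Delta>" by (simp add: coloring_def)
  then obtain x where x: "solution k n x" "monochromatic k \<Delta> x" "num_distinct k x = 2"
    using F unfolding forces_def by auto
  have "multiplicity k (x (k + 1)) = Suc (multiplicity k (x 1))"
    using two_distinct_solution[OF x(1,3) assms(1)] assms(1)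
    by (simp add: multiplicity_times_same)
  moreover have "\<Delta> (x (k + 1)) = \<Delta> (x 1)" using x(2) by (simp add: monochromatic_def)
  ultimately show False by (simp add: \<Delta>_def mod_Suc split: if_splits)
qed

text \<open>The witness is \<open>1 + ... + 1 = k\<close>.\<close>

lemma forces_one_color:
  assumes "2 \<le> k"
  shows "forces 1 k 1 k"
  unfolding forces_def
proof (intro allI impI)
  fix \<Delta> assume "coloring 1 k \<Delta>"
  then have col: "\<Delta> x = 1" if "x \<in> {1..k}" for x using that unfolding coloring_def by force
  have "set (replicate k (1::nat)) = {1}" "sum_list (replicate k (1::nat)) = k"
    using assms by (auto simp: sum_list_replicate)
  then show "\<exists>x. solution k k x \<and> monochromatic k \<Delta> x \<and> num_distinct k x = 1 + 1"
    using solution_of_list[of "replicate k 1" k k \<Delta>] assms col by auto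
qed

section \<open>Existence for two or more distinct summands, and the equivalence\<close>

lemma ex_forces:
  assumes "2 \<le> l" "l \<le> k"
  shows "\<exists>n\<ge>1. forces r k l n"
proof -
  have "1 \<le> l - 1" using assms(1) by simp
  \<comment> \<open>With \<open>q = l - 1\<close> and \<open>m = k - l\<close> there are
    \<open>m + q + 1 = k\<close> summands and \<open>q + 2 = l + 1\<close> values.\<close>
  from ex_mono_sum[OF this, where 'c = nat, of r "k - l"]
  obtain N where N: "N \<ge> 1"
    "\<And>(\<chi> :: nat \<Rightarrow> nat) C. \<lbrakk>finite C; card C = r; \<chi> ` {1..N} \<subseteq> C\<rbrakk> \<Longrightarrow> mono_sum (k - l) (l - 1) N \<chi>"
    by blast
  have eq: "k - l + (l - 1) + 1 = k" "l - 1 + 2 = l + 1" using assms by simp_all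
  have "forces r k l N" unfolding forces_def
  proof (intro allI impI)
    fix \<Delta> assume "coloring r N \<Delta>"
    then have "\<Delta> ` {1..N} \<subseteq> {1..r}" unfolding coloring_def by blast
    then have "mono_sum (k - l) (l - 1) N \<Delta>" using N(2)[of "{1..r}"] by simp
    from mono_sum_imp_solution[OF this]
    show "\<exists>x. solution k N x \<and> monochromatic k \<Delta> x \<and> num_distinct k x = l + 1"
      unfolding eq .
  qed
  with N(1) show ?thesis by blast
qed

theorem theorem2p4:
  fixes k l r :: nat
  assumes "1 \<le> l" and "1 \<le> r" and "l \<le> k" and "2 \<le> k"
  shows "(\<exists>N. S r k l = Some N) \<longleftrightarrow> 2 \<le> l \<or> r = 1"
proof -
  have "(\<exists>N. S r k l = Some N) \<longleftrightarrow> (\<exists>n\<ge>1. forces r k l n)" by (auto simp: S_def)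
  also have "\<dots> \<longleftrightarrow> 2 \<le> l \<or> r = 1"
  proof
    assume ex: "\<exists>n\<ge>1. forces r k l n"
    show "2 \<le> l \<or> r = 1"
    proof (rule ccontr)
      assume "\<not> (2 \<le> l \<or> r = 1)"
      then have "l = 1" "2 \<le> r" using assms by auto
      then show False using ex not_forces_one assms(4) by blast
    qed
  next
    assume "2 \<le> l \<or> r = 1"
    then consider "2 \<le> l" | "l = 1" "r = 1" using assms(1) by linarith
    then show "\<exists>n\<ge>1. forces r k l n"
    proof cases
      case 1
      then show ?thesis using ex_forces assms(3) by blast
    next
      case 2
      then show ?thesis using forces_one_color[OF assms(4)] assms(4) by (intro exI[of _ k]) auto
    qed
  qed
  finally show ?thesis .
qed

end
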